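(* Let $(\overline{\mathfrak{g}},\overline\alpha,\overline\omega)$ be a cosymplectic Lie algebra with Reeb vector $\overline\xi$ and bracket $\overline{[\,,\,]}$. Let $\varphi\in\mathrm{Der}(\overline{\mathfrak{g}})$, $\lambda\in\overline{\mathfrak{g}}^*$, $t\in\mathbb{R}$, and let $\mathfrak{g}=\langle d\rangle\oplus\overline{\mathfrak{g}}\oplus\langle e\rangle$ be equipped with the alternating bilinear bracket of the double extension of $\overline{\mathfrak{g}}$ by $(D,\overline\omega_\varphi)$ with $D=(\varphi,\lambda,0,t)$, that is, $$[x,y]=\overline{[x,y]}+\overline\omega_\varphi(x,y)e,\quad [x,e]=0,\quad [d,x]=\varphi(x)+\lambda(x)e,\quad [d,e]=te,\qquad x,y\in\overline{\mathfrak{g}}.$$ Let $\omega=\overline\omega+d^*\wedge e^*$ and let $\alpha\in\mathfrak{g}^*$ be such that $\alpha(x)=\overline\alpha(x)$ for all $x\in\overline{\mathfrak{g}}$, $\alpha(d)\in\mathbb{R}$ is arbitrary, and $\alpha(e)=0$. Then $(\alpha,\omega)$ defines a cosymplectic structure on $\mathfrak{g}$ (i.e. the bracket is a Lie bracket and $(\mathfrak{g},\alpha,\omega)$ is a cosymplectic Lie algebra) if and only if (a) $\overline\alpha\circ\varphi=0$, and (b) $t\,\overline\omega_\varphi-\overline\omega_{\varphi,\varphi}=\mathrm{d}\lambda$. Also, the Reeb vector is $\overline\xi$.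
   Context: A cosymplectic Lie algebra $(\mathfrak{g},\alpha,\omega)$ is a real Lie algebra of dimension $2n+1$ with $\alpha\in\mathfrak{g}^*$ and $\omega\in\wedge^2\mathfrak{g}^*$ such that $\alpha([x,y])=0$, $\omega([x,y],z)+\omega([y,z],x)+\omega([z,x],y)=0$ for all $x,y,z$, and $\alpha\wedge\omega^n\neq0$. Its Reeb vector $\xi$ is the unique vector with $\alpha(\xi)=1$, $\iota_\xi\omega=0$. Notation: $\overline\omega_\varphi(x,y)=\overline\omega(\varphi(x),y)+\overline\omega(x,\varphi(y))$, $\overline\omega_{\varphi,\varphi}(x,y)=\overline\omega_\varphi(\varphi(x),y)+\overline\omega_\varphi(x,\varphi(y))$, and $\mathrm{d}\lambda(x,y)=-\lambda(\overline{[x,y]})$ for $x,y\in\overline{\mathfrak{g}}$. The form $\overline\omega$ is extended to $\langle d\rangle\oplus\overline{\mathfrak{g}}\oplus\langle e\rangle$ by zero on $d,e$, and $d^*,e^*$ are the linear forms dual to $d,e$ vanishing on the other summands. $\mathrm{Der}(\overline{\mathfrak{g}})$ is the space of derivations of $\overline{\mathfrak{g}}$. *)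

theory Defs
  imports "HOL-Analysis.Analysis" "HOL-Combinatorics.Permutations"
begin

section \<open>Exterior products\<close>

text \<open>A \<open>k\<close>-form is encoded as a function of a sequence \<open>v\<close> of vectors that depends only on
  \<open>v 0, \<dots>, v (k - 1)\<close>. The normalisation of the exterior product is the one for which
  \<open>(f \<and> g)(x, y) = f x * g y - f y * g x\<close> on 1-forms, see \<open>wedge_one_forms\<close> below.\<close>

type_synonym 'a form = "(nat \<Rightarrow> 'a) \<Rightarrow> real"

definition one_form :: "('a \<Rightarrow> real) \<Rightarrow> 'a form" where
  "one_form f = (\<lambda>v. f (v 0))"

definition two_form :: "('a \<Rightarrow> 'a \<Rightarrow> real) \<Rightarrow> 'a form" where
  "two_form w = (\<lambda>v. w (v 0) (v 1))"

definition wedge :: "nat \<Rightarrow> nat \<Rightarrow> 'a form \<Rightarrow> 'a form \<Rightarrow> 'a form" where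
  "wedge p q f g = (\<lambda>v. (\<Sum>\<pi> | \<pi> permutes {..<p + q}.
      of_int (sign \<pi>) * f (\<lambda>i. v (\<pi> i)) * g (\<lambda>i. v (\<pi> (p + i)))) / (fact p * fact q))"

primrec wedge_power :: "nat \<Rightarrow> 'a form \<Rightarrow> nat \<Rightarrow> 'a form" where
  "wedge_power p f 0 = (\<lambda>v. 1)"
| "wedge_power p f (Suc n) = wedge p (p * n) f (wedge_power p f n)"

definition wedge11 :: "('a \<Rightarrow> real) \<Rightarrow> ('a \<Rightarrow> real) \<Rightarrow> 'a \<Rightarrow> 'a \<Rightarrow> real" where
  "wedge11 f g x y = f x * g y - f y * g x"

lemma wedge_one_forms: "wedge 1 1 (one_form f) (one_form g) = two_form (wedge11 f g)"
proof
  fix v :: "nat \<Rightarrow> 'a"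
  have "{..<Suc (Suc 0)} = {0, Suc 0}"
    by auto
  then have perms: "{\<pi>. \<pi> permutes {..<Suc (Suc 0)}} = {id, Transposition.transpose 0 (Suc 0)}"
    by (auto simp: permutes_doubleton_iff)
  have "id \<noteq> Transposition.transpose 0 (Suc 0)"
    by (auto simp: fun_eq_iff Transposition.transpose_def)
  then show "wedge 1 1 (one_form f) (one_form g) v = two_form (wedge11 f g) v"
    by (simp add: wedge_def perms one_form_def two_form_def wedge11_def sign_swap_id)
qed

section \<open>Cosymplectic Lie algebras\<close>

definition lie_bracket :: "('a::real_vector \<Rightarrow> 'a \<Rightarrow> 'a) \<Rightarrow> bool" where
  "lie_bracket br \<longleftrightarrow> bilinear br \<and> (\<forall>x. br x x = 0) \<and>
     (\<forall>x y z. br x (br y z) + br y (br z x) + br z (br x y) = 0)"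

definition derivation :: "('a::real_vector \<Rightarrow> 'a \<Rightarrow> 'a) \<Rightarrow> ('a \<Rightarrow> 'a) \<Rightarrow> bool" where
  "derivation br \<phi> \<longleftrightarrow> linear \<phi> \<and> (\<forall>x y. \<phi> (br x y) = br (\<phi> x) y + br x (\<phi> y))"

text \<open>Since \<open>dim UNIV = 0\<close> for an infinite-dimensional space, the dimension condition below
  includes finite-dimensionality.\<close>

definition cosymplectic_lie_algebra ::
  "('a::real_vector \<Rightarrow> 'a \<Rightarrow> 'a) \<Rightarrow> ('a \<Rightarrow> real) \<Rightarrow> ('a \<Rightarrow> 'a \<Rightarrow> real) \<Rightarrow> bool" where
  "cosymplectic_lie_algebra br \<alpha> \<omega> \<longleftrightarrow>
     lie_bracket br \<and> linear \<alpha> \<and> bilinear \<omega> \<and> (\<forall>x. \<omega> x x = 0) \<and>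
     (\<forall>x y. \<alpha> (br x y) = 0) \<and>
     (\<forall>x y z. \<omega> (br x y) z + \<omega> (br y z) x + \<omega> (br z x) y = 0) \<and>
     (\<exists>n. dim (UNIV :: 'a set) = 2 * n + 1 \<and>
          wedge 1 (2 * n) (one_form \<alpha>) (wedge_power 2 (two_form \<omega>) n) \<noteq> (\<lambda>v. 0))"

text \<open>\<open>\<xi>\<close> is the unique vector \<open>\<eta>\<close> with \<open>\<alpha> \<eta> = 1\<close> and \<open>\<iota>\<^sub>\<eta> \<omega> = 0\<close>.\<close>

definition is_reeb_vector :: "('a \<Rightarrow> real) \<Rightarrow> ('a \<Rightarrow> 'a \<Rightarrow> real) \<Rightarrow> 'a \<Rightarrow> bool" where
  "is_reeb_vector \<alpha> \<omega> \<xi> \<longleftrightarrow> (\<forall>\<eta>. (\<alpha> \<eta> = 1 \<and> (\<forall>y. \<omega> \<eta> y = 0)) \<longleftrightarrow> \<eta> = \<xi>)"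

definition form_der :: "('a \<Rightarrow> 'a \<Rightarrow> real) \<Rightarrow> ('a \<Rightarrow> 'a) \<Rightarrow> 'a \<Rightarrow> 'a \<Rightarrow> real" where
  "form_der \<omega> \<phi> x y = \<omega> (\<phi> x) y + \<omega> x (\<phi> y)"

definition ext_deriv :: "('a \<Rightarrow> 'a \<Rightarrow> 'a) \<Rightarrow> ('a \<Rightarrow> real) \<Rightarrow> 'a \<Rightarrow> 'a \<Rightarrow> real" where
  "ext_deriv br l x y = - l (br x y)"

section \<open>Double extensions\<close>

text \<open>The triple \<open>(a, x, b)\<close> stands for the element \<open>a d + x + b e\<close> of the direct sum of the lines
  \<open>\<langle>d\<rangle>\<close>, \<open>\<langle>e\<rangle>\<close> and the given Lie algebra.\<close>

type_synonym 'a dext = "real \<times> 'a \<times> real"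

definition d_vec :: "'a::zero dext" where "d_vec = (1, 0, 0)"
definition e_vec :: "'a::zero dext" where "e_vec = (0, 0, 1)"
definition incl :: "'a \<Rightarrow> 'a dext" where "incl x = (0, x, 0)"

definition d_dual :: "'a dext \<Rightarrow> real" where "d_dual = (\<lambda>(a, x, b). a)"
definition e_dual :: "'a dext \<Rightarrow> real" where "e_dual = (\<lambda>(a, x, b). b)"

text \<open>The alternating bilinear bracket of the double extension by \<open>(D, \<theta>)\<close>, \<open>D = (\<phi>, l, 0, t)\<close>;
  it is determined by its values on \<open>d\<close>, \<open>e\<close> and the given Lie algebra, computed below.\<close>

definition double_ext ::
  "('a::real_vector \<Rightarrow> 'a \<Rightarrow> 'a) \<Rightarrow> ('a \<Rightarrow> 'a \<Rightarrow> real) \<Rightarrow> ('a \<Rightarrow> 'a) \<Rightarrow> ('a \<Rightarrow> real) \<Rightarrow> real \<Rightarrow>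
   'a dext \<Rightarrow> 'a dext \<Rightarrow> 'a dext" where
  "double_ext br \<theta> \<phi> l t = (\<lambda>(a, x, b) (a', x', b').
     (0,
      br x x' + a *\<^sub>R \<phi> x' - a' *\<^sub>R \<phi> x,
      \<theta> x x' + a * l x' - a' * l x + t * (a * b' - a' * b)))"

lemma double_ext_values:
  fixes br :: "'a::real_vector \<Rightarrow> 'a \<Rightarrow> 'a"
  assumes "bilinear br" "bilinear \<theta>" "linear \<phi>" "linear l"
  shows "double_ext br \<theta> \<phi> l t (incl x) (incl y) = incl (br x y) + \<theta> x y *\<^sub>R e_vec"
    and "double_ext br \<theta> \<phi> l t (incl x) e_vec = 0"
    and "double_ext br \<theta> \<phi> l t d_vec (incl x) = incl (\<phi> x) + l x *\<^sub>R e_vec"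
    and "double_ext br \<theta> \<phi> l t d_vec e_vec = t *\<^sub>R e_vec"
  using assms
  by (simp_all add: double_ext_def incl_def d_vec_def e_vec_def zero_prod_def
      bilinear_lzero bilinear_rzero linear_0)

lemma double_ext_bilinear:
  assumes "bilinear br" "bilinear \<theta>" "linear \<phi>" "linear l"
  shows "bilinear (double_ext br \<theta> \<phi> l t)"
  using assms
  by (auto simp: bilinear_def linear_iff double_ext_def algebra_simps)

lemma double_ext_alternating:
  assumes "\<And>x. br x x = 0" "\<And>x. \<theta> x x = 0"
  shows "double_ext br \<theta> \<phi> l t u u = 0"
  using assms by (auto simp: double_ext_def zero_prod_def split: prod.split)

definition extend_form :: "('a \<Rightarrow> 'a \<Rightarrow> real) \<Rightarrow> 'a dext \<Rightarrow> 'a dext \<Rightarrow> real" where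
  "extend_form \<omega> = (\<lambda>(a, x, b) (a', x', b'). \<omega> x x')"

definition double_ext_form :: "('a \<Rightarrow> 'a \<Rightarrow> real) \<Rightarrow> 'a dext \<Rightarrow> 'a dext \<Rightarrow> real" where
  "double_ext_form \<omega> u v = extend_form \<omega> u v + wedge11 d_dual e_dual u v"

end

theory Submission
  imports Defs
begin

text \<open>The Jacobi identity on \<open>d, x, y\<close> is condition (b), on all other triples it holds
  automatically; \<open>\<alpha> [d, x] = 0\<close> is condition (a), and \<open>\<omega>\<close> is always closed. Nondegeneracy
  is automatic too: writing \<open>\<alpha> \<and> \<omega>\<^sup>n\<^sup>+\<^sup>1\<close> as an antisymmetrised product and evaluating it at
  \<open>x\<^sub>0, \<dots>, x\<^sub>2\<^sub>n, d, e\<close>, the vector \<open>e\<close> pairs with \<open>d\<close> only, which leaves a nonzero multiple of the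
  form of the given Lie algebra at \<open>x\<^sub>0, \<dots>, x\<^sub>2\<^sub>n\<close>.\<close>

section \<open>Antisymmetrisation\<close>

text \<open>Deliberately not divided by \<open>k!\<close>: the constants of \<open>wedge\<close> are
  tracked separately and cancel in \<open>wedge_antisymmetrize\<close>.\<close>

definition antisymmetrize :: "nat \<Rightarrow> 'a form \<Rightarrow> 'a form" where
  "antisymmetrize k h v = (\<Sum>\<pi> | \<pi> permutes {..<k}. of_int (sign \<pi>) * h (\<lambda>i. v (\<pi> i)))"

lemma antisymmetrize_0: "antisymmetrize 0 h = h"
  by (rule ext) (simp add: antisymmetrize_def)

lemma antisymmetrize_cmult: "antisymmetrize k (\<lambda>v. c * h v) v = c * antisymmetrize k h v"
  by (simp add: antisymmetrize_def sum_distrib_left mult_ac)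

lemma wedge_eq_antisymmetrize:
  "wedge p q f g = (\<lambda>v. antisymmetrize (p + q) (\<lambda>v. f v * g (\<lambda>i. v (p + i))) v / (fact p * fact q))"
  by (simp add: wedge_def antisymmetrize_def mult.assoc)

lemma of_int_sign_square [simp]: "of_int (sign \<pi>) * (of_int (sign \<pi>) * c) = (c :: real)"
  by (simp flip: mult.assoc of_int_mult)

text \<open>Permuting the slots of \<open>h\<close> amounts to the substitution
  \<open>\<pi> \<circ> \<tau>\<close> for \<open>\<pi>\<close> in the sum, and signs are
  multiplicative.\<close>

lemma antisymmetrize_compose:
  assumes "\<tau> permutes {..<k}"
  shows "antisymmetrize k (\<lambda>v. h (\<lambda>i. v (\<tau> i))) v = of_int (sign \<tau>) * antisymmetrize k h v"
proof -
  have perm: "permutation \<pi>" if "\<pi> permutes {..<k}" for \<pi>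
    using that permutation_permutes by blast
  have "antisymmetrize k h v
      = (\<Sum>\<pi> | \<pi> permutes {..<k}. of_int (sign (\<pi> \<circ> \<tau>)) * h (\<lambda>i. v ((\<pi> \<circ> \<tau>) i)))"
    unfolding antisymmetrize_def by (rule sum_permutations_compose_right[OF assms])
  also have "\<dots> = of_int (sign \<tau>) * antisymmetrize k (\<lambda>v. h (\<lambda>i. v (\<tau> i))) v"
    unfolding antisymmetrize_def sum_distrib_left
    by (intro sum.cong) (auto simp: sign_compose perm assms)
  finally show ?thesis
    by simp
qed

text \<open>The outer sum absorbs the inner one: a permutation of the last \<open>q\<close> slots
  extends, with the same sign, to one of all \<open>p + q\<close> slots that fixes the first
  \<open>p\<close>, the only slots \<open>f\<close> looks at. So each of the \<open>q!\<close> inner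
  permutations contributes the same amount.\<close>

lemma antisymmetrize_antisymmetrize:
  assumes f: "\<And>v w. (\<And>i. i < p \<Longrightarrow> v i = w i) \<Longrightarrow> f v = f w"
  shows "antisymmetrize (p + q) (\<lambda>v. f v * antisymmetrize q h (\<lambda>i. v (p + i))) v
       = fact q * antisymmetrize (p + q) (\<lambda>v. f v * h (\<lambda>i. v (p + i))) v"
proof -
  \<comment> \<open>\<open>s \<sigma>\<close> is \<sigma> transported to the block of slots from
    \<open>p\<close> to \<open>p + q - 1\<close>, and the identity elsewhere.\<close>
  define s where "s = map_permutation {..<q} ((+) p)"
  have inj: "inj_on ((+) p) {..<q}"
    by simp
  have s_perm: "s \<sigma> permutes {..<p + q}" and s_le: "\<And>i. i < p \<Longrightarrow> s \<sigma> i = i"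
    and s_ge: "\<And>i. s \<sigma> (p + i) = p + \<sigma> i" and s_sign: "sign (s \<sigma>) = sign \<sigma>"
    if \<sigma>: "\<sigma> permutes {..<q}" for \<sigma>
  proof -
    have im: "(+) p ` {..<q} = {p..<p + q}"
      using image_add_atLeastLessThan[of p 0 q] by (simp add: lessThan_atLeast0 add.commute)
    have perm: "s \<sigma> permutes {p..<p + q}"
      unfolding s_def using inj im by (intro map_permutation_permutes \<sigma>) (simp add: bij_betw_def)
    show "s \<sigma> permutes {..<p + q}"
      by (rule permutes_subset[OF perm]) auto
    show "s \<sigma> i = i" if "i < p" for i
      using permutes_not_in[OF perm] that by simp
    show "s \<sigma> (p + i) = p + \<sigma> i" for i
    proof (cases "i < q")
      case True
      then show ?thesis
        unfolding s_def by (subst map_permutation_apply) auto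
    next
      case False
      then show ?thesis
        using permutes_not_in[OF perm, of "p + i"] permutes_not_in[OF \<sigma>, of i] by simp
    qed
    show "sign (s \<sigma>) = sign \<sigma>"
      unfolding s_def by (rule sign_map_permutation[OF inj \<sigma>]) simp
  qed
  have "antisymmetrize (p + q) (\<lambda>v. f v * antisymmetrize q h (\<lambda>i. v (p + i))) v
      = (\<Sum>\<sigma> | \<sigma> permutes {..<q}. of_int (sign \<sigma>) *
          antisymmetrize (p + q) (\<lambda>v. f v * h (\<lambda>i. v (p + \<sigma> i))) v)"
    unfolding antisymmetrize_def sum_distrib_left
    by (subst sum.swap) (simp add: mult_ac)
  also have "\<dots> = (\<Sum>\<sigma> | \<sigma> permutes {..<q}.
          antisymmetrize (p + q) (\<lambda>v. f v * h (\<lambda>i. v (p + i))) v)"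
  proof (intro sum.cong refl)
    fix \<sigma> assume "\<sigma> \<in> {\<sigma>. \<sigma> permutes {..<q}}"
    then have \<sigma>: "\<sigma> permutes {..<q}"
      by simp
    have "(\<lambda>v. f v * h (\<lambda>i. v (p + \<sigma> i))) = (\<lambda>v. f (\<lambda>i. v (s \<sigma> i)) * h (\<lambda>i. v (s \<sigma> (p + i))))"
    proof
      fix v
      have "f v = f (\<lambda>i. v (s \<sigma> i))"
        by (rule f) (simp add: s_le[OF \<sigma>])
      then show "f v * h (\<lambda>i. v (p + \<sigma> i)) = f (\<lambda>i. v (s \<sigma> i)) * h (\<lambda>i. v (s \<sigma> (p + i)))"
        by (simp add: s_ge[OF \<sigma>])
    qed
    then have "antisymmetrize (p + q) (\<lambda>v. f v * h (\<lambda>i. v (p + \<sigma> i))) v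
        = of_int (sign \<sigma>) * antisymmetrize (p + q) (\<lambda>v. f v * h (\<lambda>i. v (p + i))) v"
      using antisymmetrize_compose[OF s_perm[OF \<sigma>], of "\<lambda>v. f v * h (\<lambda>i. v (p + i))" v] s_sign[OF \<sigma>]
      by simp
    then show "of_int (sign \<sigma>) * antisymmetrize (p + q) (\<lambda>v. f v * h (\<lambda>i. v (p + \<sigma> i))) v
        = antisymmetrize (p + q) (\<lambda>v. f v * h (\<lambda>i. v (p + i))) v"
      by simp
  qed
  also have "\<dots> = fact q * antisymmetrize (p + q) (\<lambda>v. f v * h (\<lambda>i. v (p + i))) v"
    by (simp add: card_permutations[of _ q])
  finally show ?thesis .
qed

text \<open>The \<open>q!\<close> from antisymmetrising twice cancels the \<open>q!\<close> in the
  normalisation of \<open>wedge\<close>; iterated wedges thus collapse to one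
  antisymmetrisation.\<close>

lemma wedge_antisymmetrize:
  assumes "\<And>v w. (\<And>i. i < p \<Longrightarrow> v i = w i) \<Longrightarrow> f v = f w"
  shows "wedge p q f (\<lambda>v. c * antisymmetrize q h v)
       = (\<lambda>v. c / fact p * antisymmetrize (p + q) (\<lambda>v. f v * h (\<lambda>i. v (p + i))) v)"
proof -
  have "antisymmetrize (p + q) (\<lambda>v. f v * (c * antisymmetrize q h (\<lambda>i. v (p + i)))) v
      = c * (fact q * antisymmetrize (p + q) (\<lambda>v. f v * h (\<lambda>i. v (p + i))) v)" for v
    unfolding mult.left_commute[of _ c] antisymmetrize_cmult
    by (subst antisymmetrize_antisymmetrize) (fact assms refl)+
  then show ?thesis
    unfolding wedge_eq_antisymmetrize by (simp add: fun_eq_iff)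
qed

lemma wedge_power_two_form:
  "wedge_power 2 (two_form w) n
     = (\<lambda>v. 1 / 2 ^ n * antisymmetrize (2 * n) (\<lambda>v. \<Prod>i<n. w (v (2 * i)) (v (2 * i + 1))) v)"
proof (induction n)
  case 0
  then show ?case
    by (simp add: antisymmetrize_0)
next
  case (Suc n)
  have "wedge_power 2 (two_form w) (Suc n)
      = (\<lambda>v. (1 / 2 ^ n) / fact 2 * antisymmetrize (2 + 2 * n) (\<lambda>v. two_form w v *
          (\<Prod>i<n. w (v (2 + 2 * i)) (v (2 + (2 * i + 1))))) v)"
    unfolding wedge_power.simps Suc by (rule wedge_antisymmetrize) (simp add: two_form_def)
  then show ?case
    \<comment> \<open>The new factor occupies slots 0 and 1 and moves the others up by two, so the
      product is split at its first index.\<close>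
    by (simp add: two_form_def prod.lessThan_Suc_shift power_commutes del: prod.lessThan_Suc)
qed

text \<open>The tensor product of \<open>f\<close> with \<open>n\<close> copies of \<open>w\<close>,
  before antisymmetrisation: slot 0 belongs to \<open>f\<close>, slots \<open>2 * i + 1\<close> and
  \<open>2 * i + 2\<close> to factor \<open>i\<close>.\<close>

definition contact_term :: "('a \<Rightarrow> real) \<Rightarrow> ('a \<Rightarrow> 'a \<Rightarrow> real) \<Rightarrow> nat \<Rightarrow> 'a form" where
  "contact_term f w n v = f (v 0) * (\<Prod>i<n. w (v (2 * i + 1)) (v (2 * i + 2)))"

lemma wedge_one_form_wedge_power:
  "wedge 1 (2 * n) (one_form f) (wedge_power 2 (two_form w) n)
     = (\<lambda>v. antisymmetrize (2 * n + 1) (contact_term f w n) v / 2 ^ n)"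
proof -
  have "wedge 1 (2 * n) (one_form f) (wedge_power 2 (two_form w) n)
      = (\<lambda>v. (1 / 2 ^ n) / fact 1 * antisymmetrize (1 + 2 * n) (\<lambda>v. one_form f v *
          (\<Prod>i<n. w (v (1 + 2 * i)) (v (1 + (2 * i + 1))))) v)"
    unfolding wedge_power_two_form by (rule wedge_antisymmetrize) (simp add: one_form_def)
  then show ?thesis
    by (simp add: one_form_def contact_term_def[abs_def])
qed

section \<open>Adding a hyperbolic pair\<close>

text \<open>Only factor \<open>i\<close> sees the transposition; its two arguments are exchanged and
  \<open>w\<close> is skew.\<close>

lemma contact_term_flip:
  assumes "\<And>x y. w x y = - w y x" "i < m"
  shows "contact_term f w m (\<lambda>j. v (Transposition.transpose (2 * i + 1) (2 * i + 2) j)) = - contact_term f w m v"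
proof -
  have "w (v (Transposition.transpose (2 * i + 1) (2 * i + 2) (2 * k + 1)))
          (v (Transposition.transpose (2 * i + 1) (2 * i + 2) (2 * k + 2)))
      = (if k = i then - 1 else 1) * w (v (2 * k + 1)) (v (2 * k + 2))" for k
  proof (cases "k = i")
    case True
    then show ?thesis
      using assms(1)[of "v (2 * i + 2)" "v (2 * i + 1)"] by simp
  next
    case False
    then have "2 * k + 1 \<notin> {2 * i + 1, 2 * i + 2}" "2 * k + 2 \<notin> {2 * i + 1, 2 * i + 2}"
      by (auto; presburger)+
    then show ?thesis
      using False by (simp add: transpose_apply_other)
  qed
  then show ?thesis
    using assms(2) by (simp add: contact_term_def prod.distrib transpose_apply_other)
qed

text \<open>Both slots of factor \<open>i\<close> trade places with those of factor
  \<open>k\<close>, which merely reorders a commutative product.\<close>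

lemma contact_term_swap:
  assumes "i < m" "k < m"
  shows "contact_term f w m
      (\<lambda>j. v (Transposition.transpose (2 * i + 1) (2 * k + 1) (Transposition.transpose (2 * i + 2) (2 * k + 2) j)))
    = contact_term f w m v" (is "contact_term f w m (\<lambda>j. v (?\<tau> j)) = _")
proof -
  have \<tau>: "?\<tau> 0 = 0" "?\<tau> (2 * j + 1) = 2 * Transposition.transpose i k j + 1"
      "?\<tau> (2 * j + 2) = 2 * Transposition.transpose i k j + 2" for j
    by (auto simp: Transposition.transpose_def; presburger)+
  have perm: "Transposition.transpose i k permutes {..<m}"
    using assms by (intro permutes_swap_id) auto
  have "(\<Prod>j<m. w (v (2 * j + 1)) (v (2 * j + 2)))
      = (\<Prod>j<m. w (v (2 * Transposition.transpose i k j + 1)) (v (2 * Transposition.transpose i k j + 2)))"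
    using prod.permute[OF perm, of "\<lambda>j. w (v (2 * j + 1)) (v (2 * j + 2))"] by (simp add: o_def)
  then show ?thesis
    by (simp only: contact_term_def \<tau>)
qed

lemma sum_lessThan_double:
  fixes f :: "nat \<Rightarrow> 'a::comm_monoid_add"
  shows "(\<Sum>j<2 * m. f j) = (\<Sum>i<m. f (2 * i) + f (2 * i + 1))"
  by (induction m) (simp_all add: add.assoc)

text \<open>Expansion along the last vector \<open>e = u (2 * n + 2)\<close>, which pairs nontrivially with
  \<open>u (2 * n + 1)\<close> only: each of the \<open>2 * (n + 1)\<close> slots of the factors \<open>w\<close> into which \<open>e\<close> can be
  put contributes the same amount.\<close>

lemma antisymmetrize_contact_term_Suc:
  assumes skew: "\<And>x y. w x y = - w y x"
    and "f (u (2 * n + 2)) = 0"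
    and "\<And>i. i < 2 * n + 1 \<Longrightarrow> w (u i) (u (2 * n + 2)) = 0"
  shows "antisymmetrize (2 * Suc n + 1) (contact_term f w (Suc n)) u
    = 2 * real (Suc n) * w (u (2 * n + 1)) (u (2 * n + 2)) * antisymmetrize (2 * n + 1) (contact_term f w n) u"
proof -
  define N where "N = {..<2 * Suc n + 1}"
  define b where "b = 2 * n + 2"
  define F where "F \<pi> = of_int (sign \<pi>) * contact_term f w (Suc n) (\<lambda>i. u (\<pi> i))" for \<pi>
  \<comment> \<open>\<open>C j\<close> is the part of the antisymmetrised sum in which slot
    \<open>j\<close> receives \<open>e\<close>, the vector with index \<open>b\<close>.\<close>
  define C where "C j = (\<Sum>\<pi> | \<pi> permutes N. if \<pi> j = b then F \<pi> else 0)" for j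
  have fin: "finite {\<pi>. \<pi> permutes N}"
    by (simp add: N_def finite_permutations)
  have perm: "permutation \<pi>" if "\<pi> permutes N" for \<pi>
    using that permutation_permutes unfolding N_def by blast
  \<comment> \<open>If the contact term changes under \<tau> exactly by \<open>sign \<tau>\<close>,
    the signed summands are invariant under \<open>\<pi> \<mapsto> \<pi> \<circ> \<tau>\<close>, a
    substitution that moves \<open>e\<close> from slot \<open>j\<close> to slot
    \<open>\<tau> j\<close>.\<close>
  have move: "C j = C (\<tau> j)" if \<tau>: "\<tau> permutes N" "\<tau> (\<tau> j) = j"
    and inv: "\<And>v. contact_term f w (Suc n) (\<lambda>i. v (\<tau> i)) = of_int (sign \<tau>) * contact_term f w (Suc n) v"
    for \<tau> j
  proof -
    have "F (\<pi> \<circ> \<tau>) = F \<pi>" if "\<pi> permutes N" for \<pi>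
    proof -
      show ?thesis
        using inv[of "\<lambda>i. u (\<pi> i)"] by (simp add: F_def sign_compose perm that \<tau> mult.assoc)
    qed
    then have "(\<Sum>\<pi> | \<pi> permutes N. if (\<pi> \<circ> \<tau>) (\<tau> j) = b then F (\<pi> \<circ> \<tau>) else 0) = C j"
      unfolding C_def by (intro sum.cong) (auto simp: \<tau>)
    then show ?thesis
      unfolding C_def[of "\<tau> j"] by (subst sum_permutations_compose_right[OF \<tau>(1)]) simp
  qed
  have flip: "C (2 * i + 1) = C (2 * i + 2)" if "i \<le> n" for i
    using move[of "Transposition.transpose (2 * i + 1) (2 * i + 2)" "2 * i + 1"]
      contact_term_flip[where w = w, OF skew, of i "Suc n" f] that
    by (simp add: permutes_swap_id N_def sign_swap_id)
  \<comment> \<open>Exchanging factor \<open>i\<close> with the last factor is an even permutation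
    of slots, matching the invariance of the contact term; for \<open>i = n\<close> it is the
    identity.\<close>
  have swap: "C (2 * i + 2) = C b" if "i \<le> n" for i
  proof -
    let ?\<tau> = "Transposition.transpose (2 * i + 1) (2 * n + 1) \<circ> Transposition.transpose (2 * i + 2) (2 * n + 2)"
    have "?\<tau> permutes N"
      using that by (intro permutes_compose permutes_swap_id) (auto simp: N_def)
    moreover have "?\<tau> (2 * i + 2) = b" "?\<tau> b = 2 * i + 2"
      by (auto simp: b_def Transposition.transpose_def; presburger)+
    moreover have "sign ?\<tau> = 1"
      by (simp add: sign_compose permutation_swap_id sign_swap_id)
    ultimately show ?thesis
      using move[of ?\<tau> "2 * i + 2"] contact_term_swap[of i "Suc n" n f w] that by simp
  qed
  have C0: "C 0 = 0"
    unfolding C_def using assms(2) by (intro sum.neutral) (auto simp: F_def contact_term_def b_def)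
  have Cb: "C b = w (u (2 * n + 1)) (u b) * antisymmetrize (2 * n + 1) (contact_term f w n) u"
  proof -
    have sub: "{\<pi>. \<pi> permutes {..<2 * n + 1}} \<subseteq> {\<pi>. \<pi> permutes N}"
      by (auto simp: N_def elim: permutes_subset)
    \<comment> \<open>With \<open>e\<close> in the last slot, its partner is the vector with index
      \<open>\<pi> (2 * n + 1)\<close>. Unless that index is \<open>2 * n + 1\<close> it is smaller,
      and the pairing vanishes; if it is, \<pi> permutes the first \<open>2 * n + 1\<close>
      indices.\<close>
    have zero: "(if \<pi> b = b then F \<pi> else 0) = 0"
      if "\<pi> \<in> {\<pi>. \<pi> permutes N} - {\<pi>. \<pi> permutes {..<2 * n + 1}}" for \<pi>
    proof (cases "\<pi> b = b")
      case True
      have \<pi>: "\<pi> permutes N"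
        using that by simp
      have "\<pi> (2 * n + 1) \<noteq> 2 * n + 1"
      proof
        assume "\<pi> (2 * n + 1) = 2 * n + 1"
        moreover have "x = 2 * n + 1 \<or> x = b" if "x \<in> N - {..<2 * n + 1}" for x
          using that by (auto simp: N_def b_def)
        ultimately have "\<pi> permutes {..<2 * n + 1}"
          using True by (intro permutes_superset[OF \<pi>]) metis
        then show False
          using that by simp
      qed
      moreover have "\<pi> (2 * n + 1) \<in> N"
        using permutes_in_image[OF \<pi>] by (simp add: N_def)
      moreover have "\<pi> (2 * n + 1) \<noteq> b"
        using True injD[OF permutes_inj[OF \<pi>], of "2 * n + 1" b] by (auto simp: b_def)
      ultimately have "\<pi> (2 * n + 1) < 2 * n + 1"
        by (auto simp: N_def b_def)
      then show ?thesis
        using True assms(3) by (simp add: F_def contact_term_def b_def)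
    qed simp
    have "C b = (\<Sum>\<pi> | \<pi> permutes {..<2 * n + 1}. if \<pi> b = b then F \<pi> else 0)"
      unfolding C_def using zero by (intro sum.mono_neutral_right fin sub) blast
    also have "\<dots> = (\<Sum>\<pi> | \<pi> permutes {..<2 * n + 1}.
        w (u (2 * n + 1)) (u b) * (of_int (sign \<pi>) * contact_term f w n (\<lambda>i. u (\<pi> i))))"
    proof (intro sum.cong refl)
      fix \<pi> assume "\<pi> \<in> {\<pi>. \<pi> permutes {..<2 * n + 1}}"
      then have "\<pi> b = b" "\<pi> (2 * n + 1) = 2 * n + 1"
        by (auto simp: b_def intro!: permutes_not_in)
      then show "(if \<pi> b = b then F \<pi> else 0)
          = w (u (2 * n + 1)) (u b) * (of_int (sign \<pi>) * contact_term f w n (\<lambda>i. u (\<pi> i)))"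
        by (simp add: F_def contact_term_def b_def)
    qed
    finally show ?thesis
      by (simp add: antisymmetrize_def sum_distrib_left)
  qed
  have "antisymmetrize (2 * Suc n + 1) (contact_term f w (Suc n)) u = (\<Sum>\<pi> | \<pi> permutes N. F \<pi>)"
    by (simp add: antisymmetrize_def F_def N_def)
  \<comment> \<open>The summands are sorted by the slot that receives \<open>e\<close>; for each
    \<pi> this is the single slot \<open>inv \<pi> b\<close>.\<close>
  also have "\<dots> = (\<Sum>\<pi> | \<pi> permutes N. \<Sum>j\<in>N. if \<pi> j = b then F \<pi> else 0)"
  proof (intro sum.cong refl)
    fix \<pi> assume "\<pi> \<in> {\<pi>. \<pi> permutes N}"
    then have \<pi>: "\<pi> permutes N"
      by simp
    have "inv \<pi> b \<in> N"
      using permutes_in_image[OF permutes_inv[OF \<pi>]] by (simp add: N_def b_def)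
    then show "F \<pi> = (\<Sum>j\<in>N. if \<pi> j = b then F \<pi> else 0)"
      by (simp add: permutes_inv_eq[OF \<pi>, symmetric] N_def)
  qed
  also have "\<dots> = (\<Sum>j<Suc (2 * Suc n). C j)"
    by (subst sum.swap) (simp add: C_def N_def)
  also have "\<dots> = (\<Sum>j<2 * Suc n. C (Suc j))"
    unfolding sum.lessThan_Suc_shift C0 by simp
  \<comment> \<open>Slot 0 is gone because \<open>f\<close> kills \<open>e\<close>; the other slots
    are grouped by factors, each giving \<open>2 * C b\<close>.\<close>
  also have "\<dots> = (\<Sum>i<Suc n. C (2 * i + 1) + C (2 * i + 2))"
    unfolding sum_lessThan_double by simp
  also have "\<dots> = (\<Sum>i<Suc n. 2 * C b)"
    by (intro sum.cong refl) (simp only: flip swap lessThan_iff less_Suc_eq_le)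
  finally show ?thesis
    unfolding Cb by (simp add: b_def)
qed

section \<open>Double extensions\<close>

text \<open>A basis of the given space, embedded by \<open>incl\<close>, becomes a basis of the sum
  once \<open>e\<close> and \<open>d\<close> are adjoined.\<close>

lemma dim_real_prod_real:
  assumes "dim (UNIV :: 'a::real_vector set) = Suc k"
  shows "dim (UNIV :: 'a dext set) = Suc k + 2"
proof -
  obtain B :: "'a set" where B: "independent B" "span B = UNIV" "card B = Suc k"
    using basis_exists[of "UNIV :: 'a set"] assms by (metis top.extremum_unique)
  \<comment> \<open>An infinite set has \<open>card\<close> 0, which the successor
    \<open>Suc k\<close> excludes.\<close>
  then have "finite B"
    using card.infinite by force
  let ?B = "incl ` B" and ?E = "insert e_vec (incl ` B)"
  have lin: "linear (incl :: 'a \<Rightarrow> 'a dext)"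
    by (rule linearI) (simp_all add: incl_def)
  have inj: "inj (incl :: 'a \<Rightarrow> 'a dext)"
    by (auto simp: inj_def incl_def)
  have span_B: "span ?B = range incl"
    using linear_span_image[OF lin, of B] B by simp
  have span_E: "span ?E = {v. fst v = 0}"
    unfolding span_insert span_B by (auto simp: e_vec_def incl_def image_iff)
  have span_D: "span (insert d_vec ?E) = UNIV"
    unfolding span_insert[of d_vec] span_E by (auto simp: d_vec_def)
  have e: "e_vec \<notin> span ?B"
    unfolding span_B by (auto simp: e_vec_def incl_def)
  have d: "d_vec \<notin> span ?E"
    unfolding span_E by (simp add: d_vec_def)
  have "independent ?B"
    using linear_independent_injective_image[OF lin B(1)] inj inj_on_subset by blast
  then have "independent (insert d_vec ?E)"
    using d e by (intro independent_insertI)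
  then have "dim (UNIV :: 'a dext set) = card (insert d_vec ?E)"
    using dim_eq_card[of "insert d_vec ?E" UNIV] span_D by simp
  also have "\<dots> = Suc (Suc (card ?B))"
  proof -
    have "e_vec \<notin> ?B" "d_vec \<notin> ?E"
      by (rule contra_subsetD[OF span_superset e], rule contra_subsetD[OF span_superset d])
    then show ?thesis
      using \<open>finite B\<close> by simp
  qed
  finally show ?thesis
    using card_image[OF inj_on_subset[OF inj]] B by simp
qed

lemma wedge_double_ext_form_nonzero:
  fixes \<omega>0 :: "'a::real_vector \<Rightarrow> 'a \<Rightarrow> real"
  assumes "linear \<alpha>" "\<And>x. \<alpha> (incl x) = \<alpha>0 x" "\<alpha> e_vec = 0"
    and "bilinear \<omega>0" and skew: "\<And>x y. \<omega>0 x y = - \<omega>0 y x"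
    and "wedge 1 (2 * n) (one_form \<alpha>0) (wedge_power 2 (two_form \<omega>0) n) \<noteq> (\<lambda>v. 0)"
  shows "wedge 1 (2 * Suc n) (one_form \<alpha>)
    (wedge_power 2 (two_form (double_ext_form \<omega>0)) (Suc n)) \<noteq> (\<lambda>v. 0)"
proof -
  let ?\<omega> = "double_ext_form \<omega>0"
  obtain v where v: "antisymmetrize (2 * n + 1) (contact_term \<alpha>0 \<omega>0 n) v \<noteq> 0"
    using assms(6) unfolding wedge_one_form_wedge_power by (auto simp: fun_eq_iff)
  \<comment> \<open>The embedded vectors are followed by \<open>d\<close> at index
    \<open>2 * n + 1\<close> and \<open>e\<close> at index \<open>2 * n + 2\<close>, as the
    expansion along the last vector requires.\<close>
  define u where "u i = (if i < 2 * n + 1 then incl (v i)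
    else if i = 2 * n + 1 then d_vec else e_vec)" for i
  \<comment> \<open>Permutations of the first \<open>2 * n + 1\<close> indices meet embedded vectors
    only, and there the extended forms restrict to the given ones.\<close>
  have "antisymmetrize (2 * n + 1) (contact_term \<alpha> ?\<omega> n) u
      = antisymmetrize (2 * n + 1) (contact_term \<alpha>0 \<omega>0 n) v"
    unfolding antisymmetrize_def
  proof (intro sum.cong refl)
    fix \<pi> assume "\<pi> \<in> {\<pi>. \<pi> permutes {..<2 * n + 1}}"
    then have "u (\<pi> i) = incl (v (\<pi> i))" if "i < 2 * n + 1" for i
      using that permutes_in_image[of \<pi> "{..<2 * n + 1}" i] by (simp add: u_def)
    moreover have "?\<omega> (incl x) (incl y) = \<omega>0 x y" for x y
      by (simp add: double_ext_form_def extend_form_def wedge11_def incl_def d_dual_def e_dual_def)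
    ultimately show "of_int (sign \<pi>) * contact_term \<alpha> ?\<omega> n (\<lambda>i. u (\<pi> i))
        = of_int (sign \<pi>) * contact_term \<alpha>0 \<omega>0 n (\<lambda>i. v (\<pi> i))"
      by (simp add: contact_term_def assms(2))
  qed
  moreover have "antisymmetrize (2 * Suc n + 1) (contact_term \<alpha> ?\<omega> (Suc n)) u
      = 2 * real (Suc n) * ?\<omega> (u (2 * n + 1)) (u (2 * n + 2)) * antisymmetrize (2 * n + 1) (contact_term \<alpha> ?\<omega> n) u"
  proof (rule antisymmetrize_contact_term_Suc)
    show "?\<omega> x y = - ?\<omega> y x" for x y
      using skew[of "fst (snd x)" "fst (snd y)"]
      by (simp add: double_ext_form_def extend_form_def wedge11_def split_beta)
    show "\<alpha> (u (2 * n + 2)) = 0"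
      by (simp add: u_def assms(3))
    show "?\<omega> (u i) (u (2 * n + 2)) = 0" if "i < 2 * n + 1" for i
      using that by (simp add: u_def double_ext_form_def extend_form_def wedge11_def incl_def e_vec_def
          d_dual_def e_dual_def bilinear_rzero[OF assms(4)])
  qed
  moreover have "?\<omega> (u (2 * n + 1)) (u (2 * n + 2)) = 1"
    by (simp add: u_def double_ext_form_def extend_form_def wedge11_def d_vec_def e_vec_def
          d_dual_def e_dual_def bilinear_rzero[OF assms(4)])
  ultimately have "antisymmetrize (2 * Suc n + 1) (contact_term \<alpha> ?\<omega> (Suc n)) u \<noteq> 0"
    using v by simp
  then show ?thesis
    unfolding wedge_one_form_wedge_power by (auto simp: fun_eq_iff)
qed

section \<open>The Jacobi identity\<close>

lemma bilinear_alternating_skew: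
  assumes "bilinear h" "\<And>x. h x x = 0"
  shows "h x y = - h y x"
proof -
  have "h x y + h y x = h (x + y) (x + y)"
    by (simp add: bilinear_ladd[OF assms(1)] bilinear_radd[OF assms(1)] assms(2)[of x] assms(2)[of y])
  also have "\<dots> = 0"
    by (rule assms(2))
  finally show ?thesis
    by (rule eq_neg_iff_add_eq_0[THEN iffD2])
qed

lemma bilinear_form_der:
  assumes "bilinear \<omega>" "linear \<phi>"
  shows "bilinear (form_der \<omega> \<phi>)"
  using assms by (auto simp: bilinear_def linear_iff form_der_def algebra_simps)

text \<open>The component of the Jacobi sum in the given algebra vanishes by its Jacobi identity and
  the Leibniz rule. In the \<open>e\<close>-component, triples from the given algebra yield
  closedness of \<theta>, and triples \<open>d, x, y\<close> yield the right-hand side.\<close>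

lemma lie_bracket_double_ext_iff:
  fixes br :: "'a::real_vector \<Rightarrow> 'a \<Rightarrow> 'a"
  assumes br: "lie_bracket br" and \<phi>: "derivation br \<phi>" and l: "linear l" and "bilinear \<theta>"
    and alt: "\<And>x. \<theta> x x = 0"
    and closed: "\<And>x y z. \<theta> (br x y) z + \<theta> (br y z) x + \<theta> (br z x) y = 0"
  shows "lie_bracket (double_ext br \<theta> \<phi> l t) \<longleftrightarrow>
    (\<forall>x y. t * \<theta> x y - form_der \<theta> \<phi> x y = ext_deriv br l x y)" (is "lie_bracket ?B \<longleftrightarrow> ?R")
proof -
  have bl: "bilinear br" and br_alt: "\<And>x. br x x = 0"
    and jac: "\<And>x y z. br x (br y z) + br y (br z x) + br z (br x y) = 0"
    and l\<phi>: "linear \<phi>" and der: "\<And>x y. \<phi> (br x y) = br (\<phi> x) y + br x (\<phi> y)"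
    using br \<phi> by (simp_all only: lie_bracket_def derivation_def)
  have br_skew: "br x y = - br y x" for x y
    by (rule bilinear_alternating_skew[OF bl br_alt])
  have skew: "\<theta> x y = - \<theta> y x" for x y
    by (rule bilinear_alternating_skew[OF assms(4) alt])
  have "lie_bracket ?B \<longleftrightarrow> (\<forall>u v w. ?B u (?B v w) + ?B v (?B w u) + ?B w (?B u v) = 0)"
    unfolding lie_bracket_def using double_ext_bilinear[OF bl assms(4) l\<phi> l]
    by (simp add: double_ext_alternating br_alt alt)
  also have "\<dots> \<longleftrightarrow> ?R"
  proof
    assume J: "\<forall>u v w. ?B u (?B v w) + ?B v (?B w u) + ?B w (?B u v) = 0"
    show ?R
    proof (intro allI)
      fix x y
      have "?B d_vec (?B (incl x) (incl y)) + ?B (incl x) (?B (incl y) d_vec) + ?B (incl y) (?B d_vec (incl x)) = 0"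
        using J by blast
      then have "l (br x y) + t * \<theta> x y - \<theta> x (\<phi> y) + \<theta> y (\<phi> x) = 0"
        by (simp add: double_ext_def incl_def d_vec_def zero_prod_def bilinear_lzero bilinear_rzero
           bl assms(4) l\<phi> l linear_0 bilinear_rneg linear_neg)
      then show "t * \<theta> x y - form_der \<theta> \<phi> x y = ext_deriv br l x y"
        using skew[of "\<phi> x" y] by (simp add: form_der_def ext_deriv_def)
    qed
  next
    assume R: ?R
    \<comment> \<open>Solved for \<open>l\<close> on brackets, the condition eliminates every such
      value from the \<open>e\<close>-component.\<close>
    have R': "l (br x y) = \<theta> (\<phi> x) y + \<theta> x (\<phi> y) - t * \<theta> x y" for x y
      using R[rule_format, of x y] by (simp add: form_der_def ext_deriv_def)
    show "\<forall>u v w. ?B u (?B v w) + ?B v (?B w u) + ?B w (?B u v) = 0"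
    proof (intro allI)
      fix u v w :: "'a dext"
      obtain a x b where u: "u = (a, x, b)" by (cases u)
      obtain a' x' b' where v: "v = (a', x', b')" by (cases v)
      obtain a'' x'' b'' where w: "w = (a'', x'', b'')" by (cases w)
      note lin_simps = bilinear_ladd bilinear_radd bilinear_lmul bilinear_rmul bilinear_lsub bilinear_rsub
         linear_add linear_diff linear_cmul
      have 1: "br x (br x' x'' + a' *\<^sub>R \<phi> x'' - a'' *\<^sub>R \<phi> x') + a *\<^sub>R \<phi> (br x' x'' + a' *\<^sub>R \<phi> x'' - a'' *\<^sub>R \<phi> x')
         + (br x' (br x'' x + a'' *\<^sub>R \<phi> x - a *\<^sub>R \<phi> x'') + a' *\<^sub>R \<phi> (br x'' x + a'' *\<^sub>R \<phi> x - a *\<^sub>R \<phi> x''))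
         + (br x'' (br x x' + a *\<^sub>R \<phi> x' - a' *\<^sub>R \<phi> x) + a'' *\<^sub>R \<phi> (br x x' + a *\<^sub>R \<phi> x' - a' *\<^sub>R \<phi> x)) = 0"
        using jac[of x x' x'']
        by (simp add: lin_simps bl l\<phi> der br_skew[of "\<phi> _"] algebra_simps)
      \<comment> \<open>The \<open>e\<close>-component: the terms in
        \<open>l \<circ> \<phi>\<close>, \<open>t * l\<close> and \<open>t * t\<close> cancel
        cyclically, those in \<open>l (br _ _)\<close> go by \<open>R'\<close>, and closedness
        removes the rest.\<close>
      have 2: "\<theta> x (br x' x'' + a' *\<^sub>R \<phi> x'' - a'' *\<^sub>R \<phi> x') + a * l (br x' x'' + a' *\<^sub>R \<phi> x'' - a'' *\<^sub>R \<phi> x')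
            + t * (a * (\<theta> x' x'' + a' * l x'' - a'' * l x' + t * (a' * b'' - a'' * b')))
         + (\<theta> x' (br x'' x + a'' *\<^sub>R \<phi> x - a *\<^sub>R \<phi> x'') + a' * l (br x'' x + a'' *\<^sub>R \<phi> x - a *\<^sub>R \<phi> x'')
            + t * (a' * (\<theta> x'' x + a'' * l x - a * l x'' + t * (a'' * b - a * b''))))
         + (\<theta> x'' (br x x' + a *\<^sub>R \<phi> x' - a' *\<^sub>R \<phi> x) + a'' * l (br x x' + a *\<^sub>R \<phi> x' - a' *\<^sub>R \<phi> x)
            + t * (a'' * (\<theta> x x' + a * l x' - a' * l x + t * (a * b' - a' * b)))) = 0"
        using closed[of x x' x''] skew[of x "br x' x''"] skew[of x' "br x'' x"] skew[of x'' "br x x'"]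
        by (simp add: lin_simps assms(4) l R' skew[of "\<phi> _"] algebra_simps)
      show "?B u (?B v w) + ?B v (?B w u) + ?B w (?B u v) = 0"
        unfolding u v w double_ext_def using 1 2 by (simp add: zero_prod_def)
    qed
  qed
  finally show ?thesis .
qed

section \<open>The Reeb vector\<close>

text \<open>Pairing \<open>(a, x, b)\<close> with \<open>e\<close> gives \<open>a\<close> and with
  \<open>d\<close> gives \<open>- b\<close>, so the kernel of the extended form lies in the embedded
  algebra, where both forms are the given ones.\<close>

lemma is_reeb_vector_double_ext:
  assumes "is_reeb_vector \<alpha>0 \<omega>0 \<xi>0" "\<And>x. \<alpha> (incl x) = \<alpha>0 x" "bilinear \<omega>0"
  shows "is_reeb_vector \<alpha> (double_ext_form \<omega>0) (incl \<xi>0)"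
  unfolding is_reeb_vector_def
proof (intro allI iffI)
  fix \<eta> :: "'a dext"
  obtain a x b where \<eta>: "\<eta> = (a, x, b)" by (cases \<eta>)
  note form_simps = \<eta> double_ext_form_def extend_form_def wedge11_def d_dual_def e_dual_def incl_def
    d_vec_def e_vec_def bilinear_rzero[OF assms(3)]
  {
    assume A: "\<alpha> \<eta> = 1 \<and> (\<forall>y. double_ext_form \<omega>0 \<eta> y = 0)"
    then have "double_ext_form \<omega>0 \<eta> e_vec = 0" "double_ext_form \<omega>0 \<eta> d_vec = 0"
      "\<And>y. double_ext_form \<omega>0 \<eta> (incl y) = 0"
      by (simp_all only: simp_thms)
    then have "a = 0" "b = 0" and 0: "\<And>y. \<omega>0 x y = 0"
      by (simp_all add: form_simps)
    then have \<eta>_x: "\<eta> = incl x"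
      by (simp add: \<eta> incl_def)
    have "\<alpha>0 x = 1"
      using A by (simp only: \<eta>_x assms(2))
    then have "x = \<xi>0"
      using assms(1) 0 unfolding is_reeb_vector_def by blast
    then show "\<eta> = incl \<xi>0"
      by (simp only: \<eta>_x)
  }
  assume "\<eta> = incl \<xi>0"
  moreover have "\<alpha>0 \<xi>0 = 1" "\<And>y. \<omega>0 \<xi>0 y = 0"
    using assms(1) unfolding is_reeb_vector_def by blast+
  ultimately show "\<alpha> \<eta> = 1 \<and> (\<forall>y. double_ext_form \<omega>0 \<eta> y = 0)"
    using assms(2) by (auto simp: form_simps)
qed

section \<open>Assembling the equivalence\<close>

theorem theorem3p2:
  fixes br :: "'a::real_vector \<Rightarrow> 'a \<Rightarrow> 'a"
    and \<alpha>0 :: "'a \<Rightarrow> real" and \<omega>0 :: "'a \<Rightarrow> 'a \<Rightarrow> real" and \<xi>0 :: 'a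
    and \<phi> :: "'a \<Rightarrow> 'a" and l :: "'a \<Rightarrow> real" and t :: real
    and \<alpha> :: "'a dext \<Rightarrow> real"
  assumes "cosymplectic_lie_algebra br \<alpha>0 \<omega>0"
    and "is_reeb_vector \<alpha>0 \<omega>0 \<xi>0"
    and "derivation br \<phi>"
    and "linear l"
    and "linear \<alpha>"
    and "\<And>x. \<alpha> (incl x) = \<alpha>0 x"
    and "\<alpha> e_vec = 0"
  defines "B \<equiv> double_ext br (form_der \<omega>0 \<phi>) \<phi> l t"
    and "\<omega> \<equiv> double_ext_form \<omega>0"
  shows "(cosymplectic_lie_algebra B \<alpha> \<omega> \<longleftrightarrow>
            (\<forall>x. \<alpha>0 (\<phi> x) = 0) \<and>
            (\<forall>x y. t * form_der \<omega>0 \<phi> x y - form_der (form_der \<omega>0 \<phi>) \<phi> x y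
                    = ext_deriv br l x y))
         \<and> (cosymplectic_lie_algebra B \<alpha> \<omega> \<longrightarrow> is_reeb_vector \<alpha> \<omega> (incl \<xi>0))"
proof -
  have lb: "lie_bracket br" and "linear \<alpha>0" and bl_\<omega>0: "bilinear \<omega>0" and alt: "\<And>x. \<omega>0 x x = 0"
    and ann: "\<And>x y. \<alpha>0 (br x y) = 0"
    and closed: "\<And>x y z. \<omega>0 (br x y) z + \<omega>0 (br y z) x + \<omega>0 (br z x) y = 0"
    using assms(1) by (simp_all only: cosymplectic_lie_algebra_def)
  obtain n where n: "dim (UNIV :: 'a set) = 2 * n + 1"
    "wedge 1 (2 * n) (one_form \<alpha>0) (wedge_power 2 (two_form \<omega>0) n) \<noteq> (\<lambda>v. 0)"
    using assms(1) unfolding cosymplectic_lie_algebra_def by blast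
  have l\<phi>: "linear \<phi>" and der: "\<And>x y. \<phi> (br x y) = br (\<phi> x) y + br x (\<phi> y)"
    using assms(3) by (simp_all only: derivation_def)
  have bl: "bilinear br" and br_alt: "\<And>x. br x x = 0"
    using lb by (simp_all only: lie_bracket_def)
  have br_skew: "br x y = - br y x" for x y
    by (rule bilinear_alternating_skew[OF bl br_alt])
  have skew: "\<omega>0 x y = - \<omega>0 y x" for x y
    by (rule bilinear_alternating_skew[OF bl_\<omega>0 alt])
  have bl_\<theta>: "bilinear (form_der \<omega>0 \<phi>)"
    by (rule bilinear_form_der[OF bl_\<omega>0 l\<phi>])
  have \<theta>_alt: "form_der \<omega>0 \<phi> x x = 0" for x
    using skew[of "\<phi> x" x] by (simp add: form_der_def)
  \<comment> \<open>Closedness of \<open>\<omega>0\<close> with \<phi> applied to each argument in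
    turn, summed up; the Leibniz rule recombines the terms containing \<phi> of a bracket.\<close>
  have \<theta>_closed: "form_der \<omega>0 \<phi> (br x y) z + form_der \<omega>0 \<phi> (br y z) x + form_der \<omega>0 \<phi> (br z x) y = 0"
    for x y z
    using closed[of "\<phi> x" y z] closed[of x "\<phi> y" z] closed[of x y "\<phi> z"]
    by (simp add: form_der_def der bilinear_ladd[OF bl_\<omega>0])
  have lie_iff: "lie_bracket B \<longleftrightarrow> (\<forall>x y. t * form_der \<omega>0 \<phi> x y - form_der (form_der \<omega>0 \<phi>) \<phi> x y
      = ext_deriv br l x y)"
    unfolding B_def by (rule lie_bracket_double_ext_iff) (fact lb assms(3,4) bl_\<theta> \<theta>_alt \<theta>_closed)+
  \<comment> \<open>Brackets have no \<open>d\<close>-component, so the value of \<alpha> at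
    \<open>d\<close> never enters; the \<open>e\<close>-component is killed by \<alpha>, and
    \<open>br x x'\<close> by \<open>\<alpha>0\<close>.\<close>
  have \<alpha>_B: "\<alpha> (B (a, x, b) (a', x', b')) = a * \<alpha>0 (\<phi> x') - a' * \<alpha>0 (\<phi> x)" for a x b a' x' b'
  proof -
    have "\<alpha> (0, y, c) = \<alpha>0 y" for y c
    proof -
      have "\<alpha> (0, y, c) = \<alpha> (incl y + c *\<^sub>R e_vec)"
        by (simp add: incl_def e_vec_def)
      also have "\<dots> = \<alpha>0 y"
        by (simp only: linear_add[OF assms(5)] linear_cmul[OF assms(5)] assms(6,7)) simp
      finally show ?thesis .
    qed
    then show ?thesis
      using \<open>linear \<alpha>0\<close> by (simp add: B_def double_ext_def linear_add linear_diff linear_cmul ann)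
  qed
  have \<alpha>_iff: "(\<forall>u v. \<alpha> (B u v) = 0) \<longleftrightarrow> (\<forall>x. \<alpha>0 (\<phi> x) = 0)"
  proof
    assume "\<forall>u v. \<alpha> (B u v) = 0"
    \<comment> \<open>The bracket of \<open>d\<close> with an embedded vector detects condition
      (a).\<close>
    then have "\<alpha> (B (1, 0, 0) (0, x, 0)) = 0" for x
      by blast
    then show "\<forall>x. \<alpha>0 (\<phi> x) = 0"
      unfolding \<alpha>_B by simp
  qed (auto simp: \<alpha>_B)
  have bl_\<omega>: "bilinear \<omega>"
    using bl_\<omega>0 unfolding \<omega>_def bilinear_def linear_iff
    by (auto simp: double_ext_form_def extend_form_def wedge11_def d_dual_def e_dual_def algebra_simps)
  have \<omega>_alt: "\<omega> u u = 0" for u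
    by (simp add: \<omega>_def double_ext_form_def extend_form_def wedge11_def alt split: prod.split)
  \<comment> \<open>On \<open>d, x, y\<close> the hyperbolic part contributes
    \<open>- form_der \<omega>0 \<phi> x y\<close>, which cancels the two terms of
    \<open>\<omega>0\<close> with \<phi>: this is why the cocycle is
    \<open>form_der \<omega>0 \<phi>\<close>. The terms in \<open>l\<close> and \<open>t\<close>
    cancel cyclically.\<close>
  have \<omega>_closed: "\<omega> (B u v) w + \<omega> (B v w) u + \<omega> (B w u) v = 0" for u v w
  proof -
    obtain a x b where u: "u = (a, x, b)" by (cases u)
    obtain a' x' b' where v: "v = (a', x', b')" by (cases v)
    obtain a'' x'' b'' where w: "w = (a'', x'', b'')" by (cases w)
    show ?thesis
      unfolding u v w \<omega>_def B_def using closed[of x x' x'']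
      by (simp add: double_ext_form_def extend_form_def wedge11_def d_dual_def e_dual_def double_ext_def
          form_der_def bilinear_ladd[OF bl_\<omega>0] bilinear_lsub[OF bl_\<omega>0] bilinear_lmul[OF bl_\<omega>0]
          skew[of _ "\<phi> _"] algebra_simps)
  qed
  have dim: "dim (UNIV :: 'a dext set) = 2 * Suc n + 1"
    using dim_real_prod_real[where 'a = 'a, of "2 * n"] n(1) by simp
  have "wedge 1 (2 * Suc n) (one_form \<alpha>) (wedge_power 2 (two_form \<omega>) (Suc n)) \<noteq> (\<lambda>v. 0)"
    unfolding \<omega>_def by (rule wedge_double_ext_form_nonzero) (fact assms(5-7) bl_\<omega>0 skew n(2))+
  with dim have nondeg: "\<exists>m. dim (UNIV :: 'a dext set) = 2 * m + 1 \<and>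
      wedge 1 (2 * m) (one_form \<alpha>) (wedge_power 2 (two_form \<omega>) m) \<noteq> (\<lambda>v. 0)"
    by blast
  \<comment> \<open>Every other clause of the definition has been established, so only the two
    conditions equivalent to (b) and (a) remain.\<close>
  have "cosymplectic_lie_algebra B \<alpha> \<omega> \<longleftrightarrow> lie_bracket B \<and> (\<forall>u v. \<alpha> (B u v) = 0)"
    unfolding cosymplectic_lie_algebra_def using assms(5) bl_\<omega> \<omega>_alt \<omega>_closed nondeg by blast
  moreover have "is_reeb_vector \<alpha> \<omega> (incl \<xi>0)"
    unfolding \<omega>_def by (rule is_reeb_vector_double_ext[OF assms(2,6) bl_\<omega>0])
  ultimately show ?thesis
    unfolding lie_iff \<alpha>_iff by blast
qed

end
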